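(* Let $\alpha \in (\frac13,1)$, $\beta \in (0,1)$ and $c \in (0,\frac12]$, and let $f : \mathbb{R}^{2\times 2} \to \mathbb{R}$ be defined by $$f(X) := \frac{(X_{1,1}-2)^2 + (X_{2,2}-3)^2 + (X_{1,2}-X_{2,1})^2}{2}.$$ Consider the minimization of $f$ on $\mathbb{R}^{2\times 2}_{\le 1}$. Starting from $X_0 := \operatorname{diag}(1,0)$ and using $\bar\alpha := \underline{\alpha} := \alpha$, $\beta$ and $c$, the algorithm $\mathrm{P}^2\mathrm{GD}$ produces the sequence $(X_i)_{i\in\mathbb{N}}$ defined by $X_i := \operatorname{diag}(2-(1-\alpha)^i, 0)$ for every $i \in \mathbb{N}$. In particular, $(X_i)_{i\in\mathbb{N}}$ converges to $\operatorname{diag}(2,0)$, $\lim_{i\to\infty} \mathrm{s}_f(X_i) = 0$, and $\mathrm{s}_f(\operatorname{diag}(2,0)) = 0$.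
   Context: $\mathbb{N}$ includes $0$. $\mathbb{R}^{2\times 2}$ carries the Frobenius inner product and $\|\cdot\|$ is the Frobenius norm; gradients are taken with respect to this inner product. $\mathbb{R}^{2\times 2}_{\le 1} := \{X \in \mathbb{R}^{2\times 2} \mid \operatorname{rank} X \le 1\}$. For a nonempty set $\mathcal{S} \subseteq \mathbb{R}^{2\times 2}$ and $X \in \mathbb{R}^{2\times 2}$, $P_{\mathcal{S}}(X) := \operatorname{argmin}_{Y\in\mathcal{S}} \|X-Y\|$ (a set, identified with its element when it is a singleton). For $X \in \mathcal{S}$, the tangent cone $T_{\mathcal{S}}(X)$ is the set of all $V \in \mathbb{R}^{2\times 2}$ for which there exist $(t_i)_{i\in\mathbb{N}}$ in $(0,\infty)$ converging to $0$ and $(V_i)_{i\in\mathbb{N}}$ in $\mathbb{R}^{2\times 2}$ converging to $V$ such that $X+t_iV_i \in \mathcal{S}$ for every $i$; it is a closed cone, and for a closed cone $\mathcal{C}$ all elements of $P_{\mathcal{C}}(X)$ have the same norm. Stationarity measure: for $X \in \mathbb{R}^{2\times 2}_{\le 1}$, $\mathrm{s}_f(X) := \|P_{T_{\mathbb{R}^{2\times 2}_{\le 1}}(X)}(-\nabla f(X))\|$ (norm of any element of this projection). $\mathrm{P}^2\mathrm{GD}$ map with parameters $0 < \underline{\alpha} \le \bar\alpha < \infty$, $\beta, c \in (0,1)$: given $X \in \mathbb{R}^{2\times 2}_{\le 1}$ with $\mathrm{s}_f(X) > 0$, choose $G \in P_{T_{\mathbb{R}^{2\times 2}_{\le 1}}(X)}(-\nabla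 f(X))$, a step size $\alpha \in [\underline{\alpha},\bar\alpha]$, and $Y \in P_{\mathbb{R}^{2\times 2}_{\le 1}}(X+\alpha G)$; while $f(Y) > f(X) - c\,\alpha\,\mathrm{s}_f(X)^2$, replace $\alpha$ by $\alpha\beta$ and choose a new $Y \in P_{\mathbb{R}^{2\times 2}_{\le 1}}(X+\alpha G)$; then return $Y$. The set of all possible outputs is $\mathrm{P}^2\mathrm{GD}(X; f,\underline{\alpha},\bar\alpha,\beta,c)$. The algorithm $\mathrm{P}^2\mathrm{GD}$ (with stopping tolerance $0$): starting from $X_0 \in \mathbb{R}^{2\times 2}_{\le 1}$, as long as $\mathrm{s}_f(X_i) > 0$, choose $X_{i+1} \in \mathrm{P}^2\mathrm{GD}(X_i; f,\underline{\alpha},\bar\alpha,\beta,c)$. "Produces the sequence $(X_i)$" means that the algorithm never stops and that its iterates are the $X_i$. *)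

theory Defs
  imports "HOL-Analysis.Analysis"
begin

(* The library's inner product and norm on real^2^2 are the Frobenius ones. *)

definition low_rank :: "(real^2^2) set" where
  "low_rank = {X. rank X \<le> 1}"

definition proj :: "'a::real_normed_vector set \<Rightarrow> 'a \<Rightarrow> 'a set" where
  "proj S X = {Y. is_arg_min (\<lambda>Y. norm (X - Y)) (\<lambda>Y. Y \<in> S) Y}"

definition tangent_cone :: "'a::real_normed_vector set \<Rightarrow> 'a \<Rightarrow> 'a set" where
  "tangent_cone S X =
     {V. \<exists>(t :: nat \<Rightarrow> real) (W :: nat \<Rightarrow> 'a).
           (\<forall>i. 0 < t i) \<and> t \<longlonglongrightarrow> 0 \<and> W \<longlonglongrightarrow> V \<and> (\<forall>i. X + t i *\<^sub>R W i \<in> S)}"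

definition grad :: "('a::real_inner \<Rightarrow> real) \<Rightarrow> 'a \<Rightarrow> 'a" where
  "grad f X = (THE D. GDERIV f X :> D)"

definition descent_dirs :: "(real^2^2 \<Rightarrow> real) \<Rightarrow> real^2^2 \<Rightarrow> (real^2^2) set" where
  "descent_dirs f X = proj (tangent_cone low_rank X) (- grad f X)"

(* All elements of the projection have the same norm, so the image is a singleton. *)
definition stationarity :: "(real^2^2 \<Rightarrow> real) \<Rightarrow> real^2^2 \<Rightarrow> real" where
  "stationarity f X = the_elem (norm ` descent_dirs f X)"

(* line_search f c \<beta> X G a Z: started with step size a, the backtracking loop can
   return Z; each rejected or accepted candidate is an arbitrary projection. *)
inductive line_search ::
  "(real^2^2 \<Rightarrow> real) \<Rightarrow> real \<Rightarrow> real \<Rightarrow> real^2^2 \<Rightarrow> real^2^2 \<Rightarrow> real \<Rightarrow> real^2^2 \<Rightarrow> bool"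
  for f c \<beta> X G where
  accept: "\<lbrakk>Y \<in> proj low_rank (X + a *\<^sub>R G); \<not> f Y > f X - c * a * (stationarity f X)\<^sup>2\<rbrakk>
    \<Longrightarrow> line_search f c \<beta> X G a Y"
| reject: "\<lbrakk>Y \<in> proj low_rank (X + a *\<^sub>R G); f Y > f X - c * a * (stationarity f X)\<^sup>2;
      line_search f c \<beta> X G (a * \<beta>) Z\<rbrakk>
    \<Longrightarrow> line_search f c \<beta> X G a Z"

definition P2GD_map ::
  "(real^2^2 \<Rightarrow> real) \<Rightarrow> real \<Rightarrow> real \<Rightarrow> real \<Rightarrow> real \<Rightarrow> real^2^2 \<Rightarrow> (real^2^2) set" where
  "P2GD_map f \<alpha>_lo \<alpha>_hi \<beta> c X =
     {Y. \<exists>G \<in> descent_dirs f X. \<exists>\<alpha> \<in> {\<alpha>_lo..\<alpha>_hi}. line_search f c \<beta> X G \<alpha> Y}"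

(* The algorithm is nondeterministic. "Produces" means that, whatever choices are made, it
   never stops and its iterates are the X i; hence the singleton rather than mere membership. *)
definition P2GD_produces ::
  "(real^2^2 \<Rightarrow> real) \<Rightarrow> real \<Rightarrow> real \<Rightarrow> real \<Rightarrow> real \<Rightarrow> real^2^2 \<Rightarrow> (nat \<Rightarrow> real^2^2) \<Rightarrow> bool" where
  "P2GD_produces f \<alpha>_lo \<alpha>_hi \<beta> c X0 X \<longleftrightarrow>
     X0 \<in> low_rank \<and> X 0 = X0 \<and>
     (\<forall>i. 0 < stationarity f (X i) \<and> P2GD_map f \<alpha>_lo \<alpha>_hi \<beta> c (X i) = {X (Suc i)})"

definition diag2 :: "real \<Rightarrow> real \<Rightarrow> real^2^2" where
  "diag2 a b = vector [vector [a, 0], vector [0, b]]"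

end

theory Submission
  imports Defs
begin

text \<open>
  At \<open>diag(x, 0)\<close> with \<open>x \<noteq> 0\<close> the tangent cone is the hyperplane \<open>V\<^sub>2\<^sub>2 = 0\<close>, so the projection of
  \<open>-\<nabla>f = diag(2 - x, 3)\<close> on it is \<open>diag(2 - x, 0)\<close>. A step along this direction stays in the set of
  diagonal matrices with vanishing second entry, hence needs no retraction, and the first step size
  \<open>\<alpha>\<close> already satisfies the Armijo condition because \<open>2c \<le> 1 \<le> 2 - \<alpha>\<close>. The distance \<open>2 - x\<close> is
  thus multiplied by \<open>1 - \<alpha>\<close> at each iteration.
\<close>

lemma diag2_nth [simp]:
  "diag2 a b $ 1 $ 1 = a" "diag2 a b $ 1 $ 2 = 0"
  "diag2 a b $ 2 $ 1 = 0" "diag2 a b $ 2 $ 2 = b"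
  by (simp_all add: diag2_def)

lemma vec2_eq_iff:
  "A = B \<longleftrightarrow> A$1$1 = B$1$1 \<and> A$1$2 = B$1$2 \<and> A$2$1 = B$2$1 \<and> A$2$2 = B$2$2"
  for A B :: "'a^2^2"
  by (auto simp: vec_eq_iff forall_2)

lemma inner_vec2:
  "A \<bullet> B = A$1$1 * B$1$1 + A$1$2 * B$1$2 + A$2$1 * B$2$1 + A$2$2 * B$2$2"
  for A B :: "real^2^2"
  by (simp add: inner_vec_def sum_2)

text \<open>A 2x2 matrix has rank at most one exactly when it is singular, so membership becomes a
  polynomial equation in the entries.\<close>

lemma low_rank_iff: "X \<in> low_rank \<longleftrightarrow> X$1$1 * X$2$2 = X$1$2 * X$2$1"
proof -
  have "X \<in> low_rank \<longleftrightarrow> det X = 0"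
    by (auto simp: low_rank_def det_eq_0_rank)
  then show ?thesis
    by (simp add: det_2)
qed

lemma diag2_scaleR_add: "diag2 a 0 + t *\<^sub>R diag2 b 0 = diag2 (a + t * b) 0"
  by (simp add: vec2_eq_iff)

lemma norm_diag2: "norm (diag2 a 0) = \<bar>a\<bar>"
  by (simp add: norm_eq_sqrt_inner inner_vec2)

lemma tendsto_diag2:
  assumes "(g \<longlongrightarrow> a) F"
  shows "((\<lambda>i. diag2 (g i) 0) \<longlongrightarrow> diag2 a 0) F"
proof -
  have "((\<lambda>i. diag2 0 0 + g i *\<^sub>R diag2 1 0) \<longlongrightarrow> diag2 0 0 + a *\<^sub>R diag2 1 0) F"
    by (intro tendsto_intros assms)
  then show ?thesis
    by (simp add: diag2_scaleR_add)
qed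

lemma proj_of_mem:
  assumes "x \<in> S"
  shows "proj S x = {x}"
  using assms by (force simp: proj_def is_arg_min_def)

text \<open>The residual \<open>D - P\<close> is orthogonal to the hyperplane, so Pythagoras gives
  both minimality and uniqueness of the minimizer \<open>P\<close>.\<close>

lemma proj_hyperplane22: "proj {V. V$2$2 = 0} D = {D - diag2 0 (D$2$2)}"
  for D :: "real^2^2"
proof -
  define P where "P = D - diag2 0 (D$2$2)"
  have pythagoras: "(norm (D - Y))\<^sup>2 = (norm (D - P))\<^sup>2 + (norm (P - Y))\<^sup>2" if "Y$2$2 = 0" for Y
    using that by (simp add: power2_norm_eq_inner inner_vec2 P_def)
  have P: "P$2$2 = 0"
    by (simp add: P_def)
  have "norm (D - P) \<le> norm (D - Y)" if "Y$2$2 = 0" for Y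
    using pythagoras[OF that] by (simp add: power2_le_imp_le)
  moreover have "norm (D - P) < norm (D - Y)" if "Y$2$2 = 0" "Y \<noteq> P" for Y
    using pythagoras[OF that(1)] that(2) by (simp add: power2_less_imp_less)
  ultimately have "proj {V. V$2$2 = 0} D = {P}"
    using P unfolding proj_def is_arg_min_def by force
  then show ?thesis
    by (simp add: P_def)
qed

lemma tangent_cone_low_rank_diag2:
  assumes "x \<noteq> 0"
  shows "tangent_cone low_rank (diag2 x 0) = {V. V$2$2 = 0}"
proof (intro equalityI subsetI)
  fix V assume "V \<in> tangent_cone low_rank (diag2 x 0)"
  then obtain t W where t: "\<And>i. 0 < t i" "t \<longlonglongrightarrow> 0" and W: "W \<longlonglongrightarrow> V"
    and mem: "\<And>i. diag2 x 0 + t i *\<^sub>R W i \<in> low_rank"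
    unfolding tangent_cone_def by blast
  \<comment> \<open>The determinant of the perturbed matrix vanishes; one factor \<open>t i\<close>
    cancels, and the limit of what remains is \<open>x * V$2$2 = 0\<close>.\<close>
  have "(x + t i * W i$1$1) * W i$2$2 = t i * (W i$1$2 * W i$2$1)" for i
  proof -
    have "t i * ((x + t i * W i$1$1) * W i$2$2) = t i * (t i * (W i$1$2 * W i$2$1))"
      using mem[of i] by (simp add: low_rank_iff algebra_simps)
    then show ?thesis
      using t(1)[of i] by simp
  qed
  moreover have "(\<lambda>i. (x + t i * W i$1$1) * W i$2$2) \<longlonglongrightarrow> (x + 0 * V$1$1) * V$2$2"
    by (intro tendsto_intros t W)
  moreover have "(\<lambda>i. t i * (W i$1$2 * W i$2$1)) \<longlonglongrightarrow> 0 * (V$1$2 * V$2$1)"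
    by (intro tendsto_intros t W)
  ultimately have "x * V$2$2 = 0"
    using LIMSEQ_unique by fastforce
  then show "V \<in> {V. V$2$2 = 0}"
    using assms by simp
next
  fix V :: "real^2^2" assume "V \<in> {V. V$2$2 = 0}"
  then have V: "V$2$2 = 0"
    by simp
  txt \<open>The curve is the product of the column \<open>(x + t V\<^sub>1\<^sub>1, t V\<^sub>2\<^sub>1)\<close> and the row
    \<open>(1, t V\<^sub>1\<^sub>2 / x)\<close>, and \<open>E\<close> is its second-order term.\<close>
  define E :: "real^2^2" where
    "E = vector [vector [0, V$1$1 * V$1$2 / x], vector [0, V$1$2 * V$2$1 / x]]"
  define t :: "nat \<Rightarrow> real" where "t = (\<lambda>i. inverse (real (Suc i)))"
  define W where "W = (\<lambda>i. V + t i *\<^sub>R E)"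
  have t: "t \<longlonglongrightarrow> 0"
    unfolding t_def by (rule LIMSEQ_inverse_real_of_nat)
  have "W \<longlonglongrightarrow> V + 0 *\<^sub>R E"
    unfolding W_def by (intro tendsto_intros t)
  then have "W \<longlonglongrightarrow> V"
    by simp
  moreover have "diag2 x 0 + t i *\<^sub>R W i \<in> low_rank" for i
    using assms V by (simp add: low_rank_iff W_def E_def field_simps)
  moreover have "0 < t i" for i
    by (simp add: t_def)
  ultimately show "V \<in> tangent_cone low_rank (diag2 x 0)"
    unfolding tangent_cone_def using t by blast
qed

lemma has_derivative_vec_nth_nth:
  "((\<lambda>A. A $ i $ j) has_derivative (\<lambda>A. A $ i $ j)) F" for i :: "'m::finite" and j :: "'n::finite"
  by (intro bounded_linear_imp_has_derivative
      bounded_linear_compose[OF bounded_linear_vec_nth bounded_linear_vec_nth])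

text \<open>As \<open>grad\<close> is a definite description, uniqueness is required: derivatives
  are unique, and a vector is determined by its inner products.\<close>

lemma grad_eqI:
  assumes "GDERIV f x :> D"
  shows "grad f x = D"
  unfolding grad_def
proof (rule the_equality)
  show "GDERIV f x :> D"
    by (rule assms)
next
  fix D' assume "GDERIV f x :> D'"
  then have "(\<lambda>h. h \<bullet> D') = (\<lambda>h. h \<bullet> D)"
    using assms unfolding gderiv_def by (rule has_derivative_unique)
  then show "D' = D"
    using vector_eq_ldot[of D' D] by metis
qed

theorem proposition5:
  fixes \<alpha> \<beta> c :: real
    and f :: "real^2^2 \<Rightarrow> real"
    and X :: "nat \<Rightarrow> real^2^2"
  assumes "1/3 < \<alpha>" "\<alpha> < 1"
    and "0 < \<beta>" "\<beta> < 1"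
    and "0 < c" "c \<le> 1/2"
    and f: "\<And>Z. f Z = ((Z$1$1 - 2)\<^sup>2 + (Z$2$2 - 3)\<^sup>2 + (Z$1$2 - Z$2$1)\<^sup>2) / 2"
    and X: "\<And>i. X i = diag2 (2 - (1 - \<alpha>) ^ i) 0"
  shows "P2GD_produces f \<alpha> \<alpha> \<beta> c (diag2 1 0) X
    \<and> X \<longlonglongrightarrow> diag2 2 0
    \<and> (\<lambda>i. stationarity f (X i)) \<longlonglongrightarrow> 0
    \<and> stationarity f (diag2 2 0) = 0"
proof -
  have f_eq: "f = (\<lambda>Z. ((Z$1$1 - 2)\<^sup>2 + (Z$2$2 - 3)\<^sup>2 + (Z$1$2 - Z$2$1)\<^sup>2) / 2)"
    by (rule ext) (rule f)
  have grad: "grad f (diag2 x 0) = diag2 (x - 2) (- 3)" for x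
    by (rule grad_eqI)
      (auto simp: gderiv_def f_eq inner_vec2 fun_eq_iff field_simps
          intro!: derivative_eq_intros has_derivative_vec_nth_nth)
  have dirs: "descent_dirs f (diag2 x 0) = {diag2 (2 - x) 0}" if "x \<noteq> 0" for x
    using that
    by (simp add: descent_dirs_def tangent_cone_low_rank_diag2 grad proj_hyperplane22 vec2_eq_iff)
  have stat: "stationarity f (diag2 x 0) = \<bar>2 - x\<bar>" if "x \<noteq> 0" for x
    using that by (simp add: stationarity_def dirs norm_diag2)
  have map: "P2GD_map f \<alpha> \<alpha> \<beta> c (diag2 x 0) = {diag2 (x + \<alpha> * (2 - x)) 0}" if "x \<noteq> 0" for x
  proof -
    let ?Z = "diag2 (x + \<alpha> * (2 - x)) 0"
    have proj: "proj low_rank (diag2 x 0 + \<alpha> *\<^sub>R diag2 (2 - x) 0) = {?Z}"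
      unfolding diag2_scaleR_add by (intro proj_of_mem) (simp add: low_rank_iff)
    \<comment> \<open>The step scales \<open>2 - x\<close> by \<open>1 - \<alpha>\<close>, so
      \<open>f\<close> drops by \<open>(1 - (1 - \<alpha>)\<^sup>2) / 2 * (2 - x)\<^sup>2\<close>,
      from which the Armijo term is subtracted.\<close>
    have "f (diag2 x 0) - c * \<alpha> * (stationarity f (diag2 x 0))\<^sup>2 - f ?Z
        = \<alpha> * (2 - \<alpha> - 2 * c) / 2 * (2 - x)\<^sup>2"
      using that by (simp add: f stat power2_eq_square field_simps)
    moreover have "0 \<le> \<alpha> * (2 - \<alpha> - 2 * c) / 2 * (2 - x)\<^sup>2"
      using assms(1,2,6) by simp
    ultimately have armijo: "\<not> f ?Z > f (diag2 x 0) - c * \<alpha> * (stationarity f (diag2 x 0))\<^sup>2"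
      by linarith
    \<comment> \<open>One unfolding suffices: the only candidate is \<open>?Z\<close>, and it is
      accepted, so the \<open>reject\<close> rule cannot apply and no choice is left.\<close>
    have "line_search f c \<beta> (diag2 x 0) (diag2 (2 - x) 0) \<alpha> Y \<longleftrightarrow> Y = ?Z" for Y
      using proj armijo by (subst line_search.simps) auto
    then show ?thesis
      using that by (auto simp: P2GD_map_def dirs)
  qed
  \<comment> \<open>The lower bound keeps the stationarity measure positive, so the algorithm never
    stops; the upper bound keeps the first entry at least 1, so the formulas for nonzero
    \<open>x\<close> apply to every iterate.\<close>
  have pos: "0 < (1 - \<alpha>) ^ i" "(1 - \<alpha>) ^ i \<le> 1" for i
    using assms(1,2) by (simp_all add: power_le_one)
  have nz: "2 - (1 - \<alpha>) ^ i \<noteq> 0" for i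
    using pos(2)[of i] by simp
  have statX: "stationarity f (X i) = (1 - \<alpha>) ^ i" for i
    using stat[OF nz[of i]] pos(1)[of i] by (simp add: X)
  have mapX: "P2GD_map f \<alpha> \<alpha> \<beta> c (X i) = {X (Suc i)}" for i
    using map[OF nz[of i]] by (simp add: X algebra_simps)
  have lim: "(\<lambda>i. (1 - \<alpha>) ^ i) \<longlonglongrightarrow> 0"
    using assms(1,2) by (intro LIMSEQ_realpow_zero) auto
  have "P2GD_produces f \<alpha> \<alpha> \<beta> c (diag2 1 0) X"
    using pos(1) by (simp add: P2GD_produces_def statX mapX low_rank_iff X[of 0])
  moreover have "X \<longlonglongrightarrow> diag2 2 0"
    unfolding X using tendsto_diag2[OF tendsto_diff[OF tendsto_const lim, of 2]] by simp
  moreover have "(\<lambda>i. stationarity f (X i)) \<longlonglongrightarrow> 0"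
    using lim by (simp add: statX)
  ultimately show ?thesis
    using stat[of 2] by simp
qed

end
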